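(* Let $d\geq 5$ and let $\overline\omega^d$ be the set of the $2^{d-1}$ points $\left(\pm\frac{1}{\sqrt d},\ldots,\pm\frac{1}{\sqrt d}\right)\in\mathbb R^d$ having an even number of minus signs (the $d$-demicube on $S^{d-1}$). Let $g$ be an admissible potential function whose second derivative $g''$ is convex on $(-1,1)$. Then the potential $p^g(\mathbf x,\overline\omega^d)=\sum_{\mathbf y\in\overline\omega^d}g(\mathbf x\cdot\mathbf y)$, $\mathbf x\in S^{d-1}$, attains its absolute minimum over $S^{d-1}$ at every point of the cross-polytope $\omega^\ast_{2d}=\{\pm\mathbf e_1,\ldots,\pm\mathbf e_d\}$ (where $\mathbf e_i$ are the standard basis vectors of $\mathbb R^d$). If, in addition, $g''$ is strictly convex on $(-1,1)$, then every point of absolute minimum of $p^g(\cdot,\overline\omega^d)$ on $S^{d-1}$ belongs to $\omega^\ast_{2d}$.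
   Context: $S^{d-1}$ is the unit sphere in $\mathbb R^d$. A function $g:[-1,1]\to(-\infty,\infty]$ is an admissible potential function if $g$ is continuous on $[-1,1)$, $g(1)=\lim_{t\to1^-}g(t)$, and $g$ is differentiable in $(-1,1)$. *)

theory Defs
  imports "HOL-Analysis.Analysis"
begin

definition real_part :: "(real \<Rightarrow> ereal) \<Rightarrow> real \<Rightarrow> real" where
  "real_part g = (\<lambda>t. real_of_ereal (g t))"

text \<open>
  Only the values of \<open>g\<close> on \<open>[-1, 1]\<close> matter. Continuity is taken in the extended reals, so
  \<open>g (-1) = \<infinity>\<close> is not excluded. Differentiability in \<open>(-1, 1)\<close> includes finiteness there, which
  has to be required separately because \<open>real_of_ereal\<close> maps infinite values to \<open>0\<close>.
\<close>

definition admissible_potential :: "(real \<Rightarrow> ereal) \<Rightarrow> bool" where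
  "admissible_potential g \<longleftrightarrow>
     (\<forall>t\<in>{-1..1}. g t \<noteq> -\<infinity>) \<and>
     continuous_on {-1..<1} g \<and>
     (g \<longlongrightarrow> g 1) (at_left 1) \<and>
     (\<forall>t\<in>{-1<..<1}. g t \<noteq> \<infinity> \<and> real_part g differentiable (at t))"

text \<open>
  Since \<open>deriv\<close> is a total function, existence of the second derivative on \<open>(-1, 1)\<close> is a
  separate condition, to be used together with \<open>admissible_potential\<close>.
\<close>

definition has_second_deriv :: "(real \<Rightarrow> ereal) \<Rightarrow> bool" where
  "has_second_deriv g \<longleftrightarrow>
     (\<forall>t\<in>{-1<..<1}. deriv (real_part g) differentiable (at t))"

definition second_deriv :: "(real \<Rightarrow> ereal) \<Rightarrow> real \<Rightarrow> real" where
  "second_deriv g = deriv (deriv (real_part g))"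

definition strictly_convex_on :: "'a::real_vector set \<Rightarrow> ('a \<Rightarrow> real) \<Rightarrow> bool" where
  "strictly_convex_on S f \<longleftrightarrow> convex S \<and>
     (\<forall>x\<in>S. \<forall>y\<in>S. \<forall>u>0. \<forall>v>0. x \<noteq> y \<longrightarrow> u + v = 1 \<longrightarrow>
        f (u *\<^sub>R x + v *\<^sub>R y) < u * f x + v * f y)"

definition demicube :: "(real ^ 'n) set" where
  "demicube =
     {y. (\<forall>i. y $ i = 1 / sqrt (real CARD('n)) \<or> y $ i = - 1 / sqrt (real CARD('n))) \<and>
         even (card {i. y $ i = - 1 / sqrt (real CARD('n))})}"

definition cross_polytope :: "(real ^ 'n) set" where
  "cross_polytope = (\<Union>i. {axis i 1, - axis i 1})"

definition potential :: "(real \<Rightarrow> ereal) \<Rightarrow> (real ^ 'n) set \<Rightarrow> real ^ 'n \<Rightarrow> ereal" where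
  "potential g \<omega> x = (\<Sum>y\<in>\<omega>. g (x \<bullet> y))"

text \<open>A sum over an infinite set would be \<open>0\<close> by convention.\<close>

lemma finite_demicube: "finite (demicube :: (real ^ 'n) set)"
proof (rule finite_subset)
  let ?A = "{1 / sqrt (real CARD('n)), - 1 / sqrt (real CARD('n))}"
  show "demicube \<subseteq> vec_lambda ` ((UNIV :: 'n set) \<rightarrow>\<^sub>E ?A)"
  proof
    fix y :: "real ^ 'n" assume "y \<in> demicube"
    then have "vec_nth y \<in> (UNIV :: 'n set) \<rightarrow>\<^sub>E ?A"
      by (auto simp: demicube_def PiE_def)
    then show "y \<in> vec_lambda ` ((UNIV :: 'n set) \<rightarrow>\<^sub>E ?A)"
      by (metis image_eqI vec_nth_inverse)
  qed
  show "finite (vec_lambda ` ((UNIV :: 'n set) \<rightarrow>\<^sub>E ?A) :: (real ^ 'n) set)"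
    by (intro finite_imageI finite_PiE) auto
qed

end

theory Submission
  imports Defs
begin

text \<open>
  Write \<open>a = 1 / sqrt d\<close>. The points of the cross-polytope have only the inner products \<open>a\<close> and
  \<open>-a\<close> with the demicube. Let \<open>h\<close> be the cubic polynomial that agrees with \<open>g\<close> to first order at
  \<open>a\<close> and \<open>-a\<close>. Convexity of \<open>g''\<close> gives \<open>h \<le> g\<close> on \<open>[-1, 1]\<close>: otherwise, adding a positive
  multiple of \<open>(t\<^sup>2 - a\<^sup>2)\<^sup>2\<close> to \<open>g - h\<close> produces a function with double zeros at \<open>a\<close> and \<open>-a\<close>, a
  third zero and a strictly convex second derivative, and by Rolle's theorem that derivative
  has three zeros. The demicube is a spherical 3-design, so the potential of \<open>h\<close> is constant on
  the sphere; it bounds the potential of \<open>g\<close> from below, with equality on the cross-polytope. In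
  the strict case a minimum point has all its inner products with the demicube in \<open>{a, -a}\<close>, and
  comparing points of the demicube that differ in two signs shows that it is \<open>e\<^sub>i\<close> or \<open>-e\<^sub>i\<close>.
\<close>

section \<open>Hermite interpolation at two points\<close>

text \<open>The middle zero is a proper convex combination of the outer two, and there strict
  convexity makes \<open>f\<close> negative.\<close>

lemma strictly_convex_on_three_zeros:
  fixes f :: "real \<Rightarrow> real"
  assumes f: "strictly_convex_on S f" and S: "p \<in> S" "r \<in> S"
    and ord: "p < q" "q < r" and zeros: "f p = 0" "f q = 0" "f r = 0"
  shows False
proof -
  define u where "u = (r - q) / (r - p)"
  have "u * (r - p) = r - q" using ord by (simp add: u_def)
  moreover have "u > 0" "1 - u > 0" using ord by (simp_all add: u_def)
  ultimately have u: "u > 0" "1 - u > 0" "u * p + (1 - u) * r = q"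
    by (simp_all add: algebra_simps)
  have "f (u *\<^sub>R p + (1 - u) *\<^sub>R r) < u * f p + (1 - u) * f r"
    using f S u(1,2) ord by (simp add: strictly_convex_on_def)
  with u(3) zeros show False by simp
qed

text \<open>Subtracting a cubic from a function changes its second derivative by an affine term.
  This lemma and its non-strict analogue carry convexity across that change.\<close>

lemma strictly_convex_on_add_affine:
  fixes f :: "real \<Rightarrow> real"
  assumes "strictly_convex_on S f"
  shows "strictly_convex_on S (\<lambda>t. f t + (b + c * t))"
  unfolding strictly_convex_on_def
proof (intro conjI ballI allI impI)
  show "convex S" using assms by (simp add: strictly_convex_on_def)
  fix x y u v :: real
  assume *: "x \<in> S" "y \<in> S" "u > 0" "v > 0" "x \<noteq> y" and uv: "u + v = 1"
  have "f (u *\<^sub>R x + v *\<^sub>R y) < u * f x + v * f y"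
    using assms * uv by (simp add: strictly_convex_on_def)
  moreover have v: "v = 1 - u" using uv by simp
  have "u * (b + c * x) + v * (b + c * y) = b + c * (u *\<^sub>R x + v *\<^sub>R y)"
    unfolding v by (simp add: algebra_simps)
  ultimately show "f (u *\<^sub>R x + v *\<^sub>R y) + (b + c * (u *\<^sub>R x + v *\<^sub>R y))
      < u * (f x + (b + c * x)) + v * (f y + (b + c * y))"
    by (simp add: distrib_left)
qed

lemma convex_on_add_affine:
  fixes f :: "real \<Rightarrow> real"
  assumes "convex_on S f"
  shows "convex_on S (\<lambda>t. f t + (b + c * t))"
proof (rule convex_on_add[OF assms])
  have "convex_on S (\<lambda>t. b + c * t)" if "convex S"
    using that
  proof (intro convex_onI)
    fix t x y :: real
    show "b + c * ((1 - t) *\<^sub>R x + t *\<^sub>R y) \<le> (1 - t) * (b + c * x) + t * (b + c * y)"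
      by (simp add: algebra_simps)
  qed
  then show "convex_on S (\<lambda>t. b + c * t)"
    using assms convex_on_imp_convex by blast
qed

text \<open>The Jensen gap of \<open>c * t\<^sup>2\<close> is exactly
  \<open>c * (u * v * (x - y)\<^sup>2)\<close>. If \<open>c > 0\<close>, this gap supplies the
  strictness; if \<open>c = 0\<close>, the strictness comes from \<open>f\<close> itself.\<close>

lemma strictly_convex_on_add_square:
  fixes f :: "real \<Rightarrow> real"
  assumes f: "convex_on S f" and c: "strictly_convex_on S f \<or> c > 0" "c \<ge> 0"
  shows "strictly_convex_on S (\<lambda>t. f t + c * t\<^sup>2)"
  unfolding strictly_convex_on_def
proof (intro conjI ballI allI impI)
  show "convex S" using f convex_on_imp_convex by blast
  fix x y u v :: real
  assume *: "x \<in> S" "y \<in> S" "u > 0" "v > 0" "x \<noteq> y" and uv: "u + v = 1"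
  have v: "v = 1 - u" using uv by simp
  have sq: "u * (c * x\<^sup>2) + v * (c * y\<^sup>2) - c * (u *\<^sub>R x + v *\<^sub>R y)\<^sup>2 = c * (u * v * (x - y)\<^sup>2)"
    unfolding v by (simp add: algebra_simps power2_eq_square)
  have pos: "u * v * (x - y)\<^sup>2 > 0" using * by simp
  have le: "f (u *\<^sub>R x + v *\<^sub>R y) \<le> u * f x + v * f y"
    using f * uv by (simp add: convex_on_def)
  have "f (u *\<^sub>R x + v *\<^sub>R y) - (u * f x + v * f y) < c * (u * v * (x - y)\<^sup>2)"
  proof (cases "c > 0")
    case True
    then have "c * (u * v * (x - y)\<^sup>2) > 0" using pos by (rule mult_pos_pos)
    with le show ?thesis by linarith
  next
    case False
    then have "f (u *\<^sub>R x + v *\<^sub>R y) < u * f x + v * f y"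
      using c * uv by (simp add: strictly_convex_on_def)
    moreover have "c * (u * v * (x - y)\<^sup>2) \<ge> 0" using c(2) pos by simp
    ultimately show ?thesis by linarith
  qed
  with sq show "f (u *\<^sub>R x + v *\<^sub>R y) + c * (u *\<^sub>R x + v *\<^sub>R y)\<^sup>2
      < u * (f x + c * x\<^sup>2) + v * (f y + c * y\<^sup>2)"
    by (simp add: distrib_left)
qed

section \<open>Rolle's theorem and functions with two double zeros\<close>

lemma Rolle_has_real_derivative:
  fixes f f' :: "real \<Rightarrow> real"
  assumes "a < b" "f a = f b" "continuous_on {a..b} f"
    and "\<And>t. a < t \<Longrightarrow> t < b \<Longrightarrow> (f has_real_derivative f' t) (at t)"
  obtains z where "a < z" "z < b" "f' z = 0"
proof -
  obtain z where "a < z" "z < b" "DERIV f z :> 0"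
    using Rolle[OF assms(1-3)] assms(4) real_differentiable_def by blast
  with assms(4) that DERIV_unique show thesis by blast
qed

text \<open>The point \<open>x\<close> may be an endpoint, where only continuity of the function is available.\<close>

lemma double_zeros_no_third_zero:
  fixes F F1 F2 :: "real \<Rightarrow> real"
  assumes a: "0 < a" "a < 1" and x: "x \<in> {-1..1}" "x \<noteq> a" "x \<noteq> -a"
    and F: "\<And>t. t \<in> {-1<..<1} \<Longrightarrow> (F has_real_derivative F1 t) (at t)"
    and F1: "\<And>t. t \<in> {-1<..<1} \<Longrightarrow> (F1 has_real_derivative F2 t) (at t)"
    and cont: "continuous_on (insert x {-1<..<1}) F"
    and zeros: "F a = 0" "F (-a) = 0" "F1 a = 0" "F1 (-a) = 0"
    and F2: "strictly_convex_on {-1<..<1} F2"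
  shows "F x \<noteq> 0"
proof
  assume Fx: "F x = 0"
  have rolle: "\<exists>z. p < z \<and> z < q \<and> F1 z = 0"
    if pq: "p \<in> insert x {-1<..<1}" "q \<in> insert x {-1<..<1}" "p < q" "F p = 0" "F q = 0" for p q
  proof -
    have "{p..q} \<subseteq> insert x {-1<..<1}" using pq x by auto
    then have c: "continuous_on {p..q} F" using cont continuous_on_subset by blast
    show ?thesis
      by (rule Rolle_has_real_derivative[of p q F F1]) (use pq x c F in auto)
  qed
  have rolle1: "\<exists>z. p < z \<and> z < q \<and> F2 z = 0"
    if pq: "-1 < p" "p < q" "q < 1" "F1 p = 0" "F1 q = 0" for p q
  proof -
    have c: "continuous_on {p..q} F1"
      by (intro continuous_at_imp_continuous_on ballI DERIV_isCont[OF F1]) (use pq in auto)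
    show ?thesis
      by (rule Rolle_has_real_derivative[of p q F1 F2]) (use pq c F1 in auto)
  qed
  \<comment> \<open>Four zeros of \<open>F1\<close> enclose three zeros of \<open>F2\<close>, too
    many for a strictly convex function.\<close>
  have four: False if ord: "-1 < p" "p < q" "q < r" "r < s" "s < 1"
      "F1 p = 0" "F1 q = 0" "F1 r = 0" "F1 s = 0" for p q r s
  proof -
    obtain z1 where "p < z1" "z1 < q" "F2 z1 = 0" using rolle1[of p q] ord by auto
    moreover obtain z2 where "q < z2" "z2 < r" "F2 z2 = 0" using rolle1[of q r] ord by auto
    moreover obtain z3 where "r < z3" "z3 < s" "F2 z3 = 0" using rolle1[of r s] ord by auto
    ultimately show False
      using ord by (intro strictly_convex_on_three_zeros[OF F2, of z1 z3 z2]) auto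
  qed
  \<comment> \<open>Wherever \<open>x\<close> lies, Rolle between consecutive zeros among
    \<open>x\<close>, \<open>-a\<close> and \<open>a\<close> gives two zeros of \<open>F1\<close>
    besides \<open>-a\<close> and \<open>a\<close>.\<close>
  consider "x < -a" | "-a < x" "x < a" | "a < x" using x by linarith
  then show False
  proof cases
    case 1
    obtain z1 where "x < z1" "z1 < -a" "F1 z1 = 0" using rolle[of x "-a"] 1 a zeros Fx by auto
    moreover obtain z2 where "-a < z2" "z2 < a" "F1 z2 = 0" using rolle[of "-a" a] a zeros by auto
    ultimately show ?thesis using four[of z1 "-a" z2 a] a x zeros by auto
  next
    case 2
    obtain z1 where "-a < z1" "z1 < x" "F1 z1 = 0" using rolle[of "-a" x] 2 a zeros Fx by auto
    moreover obtain z2 where "x < z2" "z2 < a" "F1 z2 = 0" using rolle[of x a] 2 a zeros Fx by auto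
    ultimately show ?thesis using four[of "-a" z1 z2 a] a x zeros by auto
  next
    case 3
    obtain z1 where "-a < z1" "z1 < a" "F1 z1 = 0" using rolle[of "-a" a] a zeros by auto
    moreover obtain z2 where "a < z2" "z2 < x" "F1 z2 = 0" using rolle[of a x] 3 a zeros Fx by auto
    ultimately show ?thesis using four[of "-a" z1 a z2] a x zeros by auto
  qed
qed

text \<open>If \<open>F x\<close> had the wrong sign, a nonnegative multiple of
  \<open>(t\<^sup>2 - a\<^sup>2)\<^sup>2\<close> would cancel it. The sum would keep the double
  zeros, gain the zero \<open>x\<close> and have a strictly convex second derivative, which is
  impossible.\<close>

lemma double_zeros_sign:
  fixes F F1 F2 :: "real \<Rightarrow> real"
  assumes a: "0 < a" "a < 1" and x: "x \<in> {-1..1}" "x \<noteq> a" "x \<noteq> -a"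
    and F: "\<And>t. t \<in> {-1<..<1} \<Longrightarrow> (F has_real_derivative F1 t) (at t)"
    and F1: "\<And>t. t \<in> {-1<..<1} \<Longrightarrow> (F1 has_real_derivative F2 t) (at t)"
    and cont: "continuous_on (insert x {-1<..<1}) F"
    and zeros: "F a = 0" "F (-a) = 0" "F1 a = 0" "F1 (-a) = 0"
    and F2: "convex_on {-1<..<1} F2"
  shows "F x \<ge> 0" and "strictly_convex_on {-1<..<1} F2 \<Longrightarrow> F x > 0"
proof -
  \<comment> \<open>Chosen so that \<open>K x = 0\<close>; the sign of \<open>c\<close> is opposite
    to that of \<open>F x\<close>.\<close>
  define c where "c = - F x / (x\<^sup>2 - a\<^sup>2)\<^sup>2"
  define K where "K = (\<lambda>t. F t + c * (t\<^sup>2 - a\<^sup>2)\<^sup>2)"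
  define K1 where "K1 = (\<lambda>t. F1 t + c * (4 * t * (t\<^sup>2 - a\<^sup>2)))"
  \<comment> \<open>The added part of the second derivative is
    \<open>c * (12 * t\<^sup>2 - 4 * a\<^sup>2)\<close>, split here into a square and an affine term
    \<open>b + c * t\<close> with slope \<open>0\<close> to match the two convexity lemmas.\<close>
  define K2 where "K2 = (\<lambda>t. (F2 t + (12 * c) * t\<^sup>2) + (- (4 * c * a\<^sup>2) + 0 * t))"
  have x2: "x\<^sup>2 - a\<^sup>2 \<noteq> 0" using x by (simp add: power2_eq_iff)
  have "K x = 0" using x2 by (simp add: K_def c_def)
  have not_strict: "\<not> strictly_convex_on {-1<..<1} K2"
  proof
    assume K2: "strictly_convex_on {-1<..<1} K2"
    have "K x \<noteq> 0"
    proof (rule double_zeros_no_third_zero[OF a x _ _ _ _ _ _ _ K2])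
      show "(K has_real_derivative K1 t) (at t)" if "t \<in> {-1<..<1}" for t
        unfolding K_def K1_def
        by (rule derivative_eq_intros F[OF that] refl)+ (simp add: algebra_simps)
      show "(K1 has_real_derivative K2 t) (at t)" if "t \<in> {-1<..<1}" for t
        unfolding K1_def K2_def
        by (rule derivative_eq_intros F1[OF that] refl)+ (simp add: algebra_simps power2_eq_square)
      show "continuous_on (insert x {-1<..<1}) K"
        unfolding K_def by (intro continuous_intros cont)
    qed (simp_all add: K_def K1_def zeros)
    with \<open>K x = 0\<close> show False by simp
  qed
  have "\<not> (c > 0)"
    using not_strict strictly_convex_on_add_square[OF F2, of "12 * c"]
      strictly_convex_on_add_affine[of _ "\<lambda>t. F2 t + (12 * c) * t\<^sup>2"] unfolding K2_def by fastforce
  then show "F x \<ge> 0"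
    using x2 by (simp add: c_def not_less zero_le_divide_iff)
  assume "strictly_convex_on {-1<..<1} F2"
  then have "\<not> (c \<ge> 0)"
    using not_strict strictly_convex_on_add_square[OF F2, of "12 * c"]
      strictly_convex_on_add_affine[of _ "\<lambda>t. F2 t + (12 * c) * t\<^sup>2"] unfolding K2_def by fastforce
  then show "F x > 0"
    using x2 by (simp add: c_def not_le zero_less_divide_iff)
qed

text \<open>The nodes are symmetric, so the system splits by parity: \<open>u + v\<close> and
  \<open>u' - v'\<close> determine the even coefficients, \<open>u - v\<close> and
  \<open>u' + v'\<close> the odd ones.\<close>

lemma cubic_Hermite_interpolation:
  fixes a :: real
  assumes "a \<noteq> 0"
  obtains c0 c1 c2 c3 :: real where
    "c0 + c1 * a + c2 * a\<^sup>2 + c3 * a ^ 3 = u" "c0 - c1 * a + c2 * a\<^sup>2 - c3 * a ^ 3 = v"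
    "c1 + 2 * c2 * a + 3 * c3 * a\<^sup>2 = u'" "c1 - 2 * c2 * a + 3 * c3 * a\<^sup>2 = v'"
proof -
  define c2 where "c2 = (u' - v') / (4 * a)"
  define c0 where "c0 = (u + v) / 2 - c2 * a\<^sup>2"
  define c3 where "c3 = ((u' + v') * a - (u - v)) / (4 * a ^ 3)"
  define c1 where "c1 = (u' + v') / 2 - 3 * c3 * a\<^sup>2"
  show thesis
  proof
    have c2: "4 * (c2 * a) = u' - v'" using assms by (simp add: c2_def)
    have c3: "4 * (c3 * a ^ 3) = (u' + v') * a - (u - v)" using assms by (simp add: c3_def)
    have c1: "c1 * a = (u' + v') * a / 2 - 3 * (c3 * a ^ 3)"
      by (simp add: c1_def algebra_simps power2_eq_square power3_eq_cube)
    show "c0 + c1 * a + c2 * a\<^sup>2 + c3 * a ^ 3 = u"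
      using c1 c3 by (simp add: c0_def) argo
    show "c0 - c1 * a + c2 * a\<^sup>2 - c3 * a ^ 3 = v"
      using c1 c3 by (simp add: c0_def) argo
    show "c1 + 2 * c2 * a + 3 * c3 * a\<^sup>2 = u'" using c2 by (simp add: c1_def) argo
    show "c1 - 2 * c2 * a + 3 * c3 * a\<^sup>2 = v'" using c2 by (simp add: c1_def) argo
  qed
qed

section \<open>Admissible potentials and their cubic minorants\<close>

lemma admissible_potential_finite:
  assumes "admissible_potential g" "t \<in> {-1<..<1}"
  shows "g t = ereal (real_part g t)"
  using assms by (cases "g t") (auto simp: admissible_potential_def real_part_def)

text \<open>Rolle's theorem up to an endpoint needs continuity there. At \<open>1\<close> it comes
  from the left limit, at \<open>-1\<close> from continuity on the half-open interval; finiteness of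
  \<open>g x\<close> transfers it from \<open>ereal\<close> to the reals.\<close>

lemma admissible_potential_continuous_on:
  assumes g: "admissible_potential g" and x: "x \<in> {-1..1}" "g x \<noteq> \<infinity>"
  shows "continuous_on (insert x {-1<..<1}) (real_part g)"
proof -
  have "continuous_on (insert x {-1<..<1}) g"
  proof (cases "x = 1")
    case True
    have c: "continuous_on {-1<..<1} g"
      using g continuous_on_subset[of "{-1..<1}" g "{-1<..<1}"]
      by (force simp: admissible_potential_def)
    have l: "(g \<longlongrightarrow> g 1) (at_left 1)" using g by (simp add: admissible_potential_def)
    show ?thesis
      unfolding continuous_on_def
    proof
      fix y assume y: "y \<in> insert x {-1<..<1::real}"
      show "(g \<longlongrightarrow> g y) (at y within insert x {-1<..<1})"
      proof (cases "y = 1")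
        case True
        \<comment> \<open>Within this set the point \<open>1\<close> is approached only from the
          left, so the one-sided limit suffices.\<close>
        have "at 1 within insert 1 {-1<..<1} \<le> at_left (1::real)"
          unfolding at_within_def by (intro inf_mono order_refl) auto
        then show ?thesis using True \<open>x = 1\<close> l tendsto_mono by blast
      next
        case False
        with y True have "y \<in> {-1<..<1}" by auto
        then have "(g \<longlongrightarrow> g y) (at y)"
          using c by (metis continuous_on_def at_within_open open_greaterThanLessThan)
        then show ?thesis by (rule tendsto_within_subset) simp
      qed
    qed
  next
    case False
    with x g show ?thesis
      by (auto simp: admissible_potential_def elim!: continuous_on_subset)
  qed
  moreover have "\<bar>g t\<bar> \<noteq> \<infinity>" if "t \<in> insert x {-1<..<1}" for t
    using that x g by (auto simp: admissible_potential_def)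
  ultimately show ?thesis
    unfolding real_part_def using continuous_on_iff_real[of "insert x {-1<..<1}" g]
    by (simp add: comp_def)
qed

text \<open>The difference \<open>F\<close> between \<open>g\<close> and its Hermite cubic has
  double zeros at \<open>a\<close> and \<open>-a\<close>, and its second derivative differs from
  that of \<open>g\<close> by an affine function, so \<open>double_zeros_sign\<close> applies where
  \<open>g\<close> is finite. Where \<open>g\<close> is infinite, the bound is trivial.\<close>

lemma admissible_potential_cubic_minorant:
  assumes g: "admissible_potential g" "has_second_deriv g"
    and conv: "convex_on {-1<..<1} (second_deriv g)" and a: "0 < a" "a < 1"
  obtains c0 c1 c2 c3 :: real where
    "\<And>t. t = a \<or> t = - a \<Longrightarrow> g t = ereal (c0 + c1 * t + c2 * t\<^sup>2 + c3 * t ^ 3)"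
    "\<And>t. t \<in> {-1..1} \<Longrightarrow> ereal (c0 + c1 * t + c2 * t\<^sup>2 + c3 * t ^ 3) \<le> g t"
    "\<And>t. strictly_convex_on {-1<..<1} (second_deriv g) \<Longrightarrow> t \<in> {-1..1} \<Longrightarrow> t \<noteq> a \<Longrightarrow> t \<noteq> - a \<Longrightarrow>
       ereal (c0 + c1 * t + c2 * t\<^sup>2 + c3 * t ^ 3) < g t"
proof -
  define G where "G = real_part g"
  define G1 where "G1 = deriv G"
  define G2 where "G2 = second_deriv g"
  have G: "(G has_real_derivative G1 t) (at t)" if "t \<in> {-1<..<1}" for t
    using g(1) that unfolding admissible_potential_def G_def G1_def
    by (metis DERIV_deriv_iff_real_differentiable)
  have G1: "(G1 has_real_derivative G2 t) (at t)" if "t \<in> {-1<..<1}" for t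
    using g(2) that unfolding has_second_deriv_def second_deriv_def G_def G1_def G2_def
    by (metis DERIV_deriv_iff_real_differentiable)
  obtain c0 c1 c2 c3 where c:
    "c0 + c1 * a + c2 * a\<^sup>2 + c3 * a ^ 3 = G a" "c0 - c1 * a + c2 * a\<^sup>2 - c3 * a ^ 3 = G (-a)"
    "c1 + 2 * c2 * a + 3 * c3 * a\<^sup>2 = G1 a" "c1 - 2 * c2 * a + 3 * c3 * a\<^sup>2 = G1 (-a)"
    using cubic_Hermite_interpolation a by (metis less_irrefl)
  define h where "h = (\<lambda>t. c0 + c1 * t + c2 * t\<^sup>2 + c3 * t ^ 3)"
  define F where "F = (\<lambda>t. G t - h t)"
  define F1 where "F1 = (\<lambda>t. G1 t - (c1 + 2 * c2 * t + 3 * c3 * t\<^sup>2))"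
  define F2 where "F2 = (\<lambda>t. G2 t + (- (2 * c2) + (- (6 * c3)) * t))"
  have eq: "g t = ereal (h t)" if "t = a \<or> t = - a" for t
  proof -
    have "g t = ereal (G t)" using admissible_potential_finite[OF g(1), of t] that a
      by (auto simp: G_def)
    also have "G t = h t" using that c by (auto simp: h_def)
    finally show ?thesis .
  qed
  have F: "(F has_real_derivative F1 t) (at t)" if "t \<in> {-1<..<1}" for t
    unfolding F_def F1_def h_def
    by (rule derivative_eq_intros G[OF that] refl)+ (simp add: algebra_simps)
  have F1: "(F1 has_real_derivative F2 t) (at t)" if "t \<in> {-1<..<1}" for t
    unfolding F1_def F2_def
    by (rule derivative_eq_intros G1[OF that] refl)+ (simp add: algebra_simps)
  have zeros: "F a = 0" "F (-a) = 0" "F1 a = 0" "F1 (-a) = 0"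
    using c by (simp_all add: F_def F1_def h_def)
  have F2: "convex_on {-1<..<1} F2"
    using conv unfolding F2_def G2_def by (rule convex_on_add_affine)
  have F2': "strictly_convex_on {-1<..<1} F2" if "strictly_convex_on {-1<..<1} (second_deriv g)"
    using that unfolding F2_def G2_def by (rule strictly_convex_on_add_affine)
  have fin: "g t = ereal (F t + h t)" "continuous_on (insert t {-1<..<1}) F"
    if "t \<in> {-1..1}" "g t \<noteq> \<infinity>" for t
  proof -
    have "g t \<noteq> - \<infinity>" using that g(1) by (simp add: admissible_potential_def)
    with that(2) show "g t = ereal (F t + h t)"
      by (cases "g t") (auto simp: F_def G_def real_part_def)
    show "continuous_on (insert t {-1<..<1}) F"
      unfolding F_def h_def G_def
      by (intro continuous_intros admissible_potential_continuous_on g that)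
  qed
  show thesis
  proof
    show "g t = ereal (c0 + c1 * t + c2 * t\<^sup>2 + c3 * t ^ 3)" if "t = a \<or> t = - a" for t
      using eq[OF that] by (simp add: h_def)
    show "ereal (c0 + c1 * t + c2 * t\<^sup>2 + c3 * t ^ 3) \<le> g t" if t: "t \<in> {-1..1}" for t
    proof (cases "g t = \<infinity> \<or> t = a \<or> t = - a")
      case True
      then show ?thesis using eq[of t] by (auto simp: h_def)
    next
      case False
      then have "F t \<ge> 0"
        using double_zeros_sign(1)[OF a t _ _ F F1 _ zeros F2] fin(2) t by blast
      then show ?thesis using fin(1)[OF t] False by (simp add: h_def)
    qed
    show "ereal (c0 + c1 * t + c2 * t\<^sup>2 + c3 * t ^ 3) < g t"
      if s: "strictly_convex_on {-1<..<1} (second_deriv g)"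
        and t: "t \<in> {-1..1}" "t \<noteq> a" "t \<noteq> - a" for t
    proof (cases "g t = \<infinity>")
      case True
      then show ?thesis by simp
    next
      case False
      then have "F t > 0"
        using double_zeros_sign(2)[OF a t F F1 _ zeros F2 F2'[OF s]] fin(2) t by blast
      then show ?thesis using fin(1)[OF t(1)] False by (simp add: h_def)
    qed
  qed
qed

section \<open>Moments of the demicube\<close>

text \<open>A single flip reverses the parity of the number of minus signs and so leaves the
  demicube; the symmetries used below are compositions of two flips.\<close>

definition flip :: "'n \<Rightarrow> real ^ 'n \<Rightarrow> real ^ 'n" where
  "flip p y = (\<chi> k. if k = p then - y $ k else y $ k)"

lemma flip_nth [simp]: "flip p y $ k = (if k = p then - y $ k else y $ k)"
  by (simp add: flip_def)

lemma flip_flip [simp]: "flip p (flip p y) = y"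
  by (simp add: vec_eq_iff)

lemma flip_commute: "flip p (flip q y) = flip q (flip p y)"
  by (simp add: vec_eq_iff)

text \<open>The flip inserts \<open>p\<close> into the set of negative coordinates or removes it,
  changing its cardinality by one.\<close>

lemma even_card_flip:
  fixes y :: "real ^ 'n::finite"
  assumes "a > 0" "\<And>i. y $ i = a \<or> y $ i = - a"
  shows "even (card {i. flip p y $ i = - a}) \<longleftrightarrow> odd (card {i. y $ i = - a})"
proof (cases "y $ p = a")
  case True
  then have "{i. flip p y $ i = - a} = insert p {i. y $ i = - a}" and "p \<notin> {i. y $ i = - a}"
    using assms(1) by auto
  then show ?thesis by simp
next
  case False
  then have "y $ p = - a" using assms(2) by blast
  then have "{i. y $ i = - a} = insert p {i. flip p y $ i = - a}"
    and "p \<notin> {i. flip p y $ i = - a}"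
    using assms(1) by auto
  then show ?thesis by simp
qed

lemma demicube_nth:
  fixes y :: "real ^ 'n::finite"
  assumes "y \<in> demicube"
  shows "y $ i = 1 / sqrt (real CARD('n)) \<or> y $ i = - (1 / sqrt (real CARD('n)))"
  using assms by (simp add: demicube_def)

lemma flip_flip_in_demicube:
  fixes y :: "real ^ 'n::finite"
  assumes y: "y \<in> demicube"
  shows "flip p (flip q y) \<in> demicube"
proof -
  define a where "a = 1 / sqrt (real CARD('n))"
  have a: "a > 0" by (simp add: a_def)
  have *: "y $ i = a \<or> y $ i = - a" for i
    using demicube_nth[OF y] by (simp add: a_def)
  then have **: "flip q y $ i = a \<or> flip q y $ i = - a" for i by (metis flip_nth minus_minus)
  have ***: "flip p (flip q y) $ i = a \<or> flip p (flip q y) $ i = - a" for i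
    using ** by (metis flip_nth minus_minus)
  have "even (card {i. y $ i = - a})" using y by (simp add: demicube_def a_def)
  then have "even (card {i. flip p (flip q y) $ i = - a})"
    using even_card_flip[OF a *] even_card_flip[OF a **] by blast
  with *** show ?thesis
    unfolding demicube_def a_def by simp
qed

text \<open>The double flip is an involution of the demicube, so reindexing by it shows that the sum
  equals its own negative.\<close>

lemma sum_demicube_antisymmetric:
  fixes \<phi> :: "real ^ 'n::finite \<Rightarrow> real"
  assumes "\<And>y. \<phi> (flip p (flip q y)) = - \<phi> y"
  shows "(\<Sum>y\<in>demicube. \<phi> y) = 0"
proof -
  have "(\<Sum>y\<in>demicube. \<phi> y) = (\<Sum>y\<in>demicube. - \<phi> y)"
  proof (rule sum.reindex_bij_witness[where i = "\<lambda>y. flip p (flip q y)" and j = "\<lambda>y. flip p (flip q y)"])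
    fix y :: "real ^ 'n" assume "y \<in> demicube"
    show "flip p (flip q (flip p (flip q y))) = y" "flip p (flip q (flip p (flip q y))) = y"
      by (simp_all add: flip_commute[of q p])
    show "flip p (flip q y) \<in> demicube" "flip p (flip q y) \<in> demicube"
      by (rule flip_flip_in_demicube, fact)+
    show "- \<phi> (flip p (flip q y)) = \<phi> y" by (simp add: assms)
  qed
  then show ?thesis by (simp add: sum_negf)
qed

text \<open>Supplies the second index of a double flip: flipping a coordinate that is absent from a
  monomial restores the parity without changing the monomial.\<close>

lemma obtain_fresh_index:
  fixes A :: "'n::finite set"
  assumes "card A < CARD('n)"
  obtains q where "q \<notin> A"
  using assms by (metis UNIV_I equalityI less_irrefl subsetI)

section \<open>Moments of degree one to three\<close>

lemma sum_demicube_inner: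
  fixes x :: "real ^ 'n::finite"
  assumes "CARD('n) \<ge> 2"
  shows "(\<Sum>y\<in>demicube. x \<bullet> y) = 0"
proof -
  have "(\<Sum>y\<in>(demicube :: (real ^ 'n) set). y $ i) = 0" for i
  proof -
    obtain q where "q \<notin> {i}" using obtain_fresh_index[of "{i}"] assms by auto
    then show ?thesis by (intro sum_demicube_antisymmetric[of _ i q]) auto
  qed
  then show ?thesis
    by (simp add: inner_vec_def sum.swap[of _ UNIV demicube] flip: sum_distrib_left)
qed

text \<open>After expansion into products of two coordinates, the mixed ones sum to zero by
  antisymmetry, while each squared coordinate is the constant
  \<open>1 / real CARD('n)\<close>.\<close>

lemma sum_demicube_inner_square:
  fixes x :: "real ^ 'n::finite"
  assumes "CARD('n) \<ge> 3"
  shows "(\<Sum>y\<in>demicube. (x \<bullet> y)\<^sup>2)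
    = (norm x)\<^sup>2 * (real (card (demicube :: (real ^ 'n) set)) / real CARD('n))"
proof -
  let ?D = "demicube :: (real ^ 'n) set"
  have zero: "(\<Sum>y\<in>?D. y $ i * y $ j) = 0" if "i \<noteq> j" for i j
  proof -
    have "card {i, j} \<le> 2" by (simp add: card_insert_if)
    then obtain q where "q \<notin> {i, j}" using obtain_fresh_index[of "{i, j}"] assms by auto
    then show ?thesis using that by (intro sum_demicube_antisymmetric[of _ i q]) auto
  qed
  have sq: "(\<Sum>y\<in>?D. y $ i * y $ i) = real (card ?D) / real CARD('n)" for i
  proof -
    have "y $ i * y $ i = 1 / real CARD('n)" if "y \<in> ?D" for y
      using demicube_nth[OF that, of i] by auto
    then show ?thesis by simp
  qed
  have "(\<Sum>y\<in>?D. (x \<bullet> y)\<^sup>2) = (\<Sum>y\<in>?D. \<Sum>i\<in>UNIV. \<Sum>j\<in>UNIV. x $ i * x $ j * (y $ i * y $ j))"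
    by (simp add: power2_eq_square inner_vec_def sum_product mult_ac)
  also have "\<dots> = (\<Sum>i\<in>UNIV. \<Sum>j\<in>UNIV. x $ i * x $ j * (\<Sum>y\<in>?D. y $ i * y $ j))"
    by (simp add: sum.swap[of _ UNIV ?D] sum_distrib_left)
  also have "\<dots> = (\<Sum>i\<in>UNIV. \<Sum>j\<in>UNIV. if i = j then x $ i * x $ i * (real (card ?D) / real CARD('n)) else 0)"
    by (intro sum.cong refl) (auto simp: zero sq)
  also have "\<dots> = (norm x)\<^sup>2 * (real (card ?D) / real CARD('n))"
    by (simp only: sum.delta' sum.delta finite UNIV_I if_True power2_norm_eq_inner inner_vec_def
        inner_real_def sum_distrib_right)
  finally show ?thesis .
qed

text \<open>A cubic monomial involves at most three indices, so in dimension at least 4 one index is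
  free for the second flip and every monomial sums to zero.\<close>

lemma sum_demicube_inner_cube:
  fixes x :: "real ^ 'n::finite"
  assumes "CARD('n) \<ge> 4"
  shows "(\<Sum>y\<in>demicube. (x \<bullet> y) ^ 3) = 0"
proof -
  let ?D = "demicube :: (real ^ 'n) set"
  have zero: "(\<Sum>y\<in>?D. y $ i * y $ j * y $ k) = 0" for i j k
  proof -
    have "card {i, j, k} \<le> 3" by (simp add: card_insert_if)
    then obtain q where q: "q \<notin> {i, j, k}" using obtain_fresh_index[of "{i, j, k}"] assms by auto
    \<comment> \<open>Some index occurs an odd number of times among \<open>i, j, k\<close>.\<close>
    consider "i = j" | "i \<noteq> j" "i = k" | "i \<noteq> j" "i \<noteq> k" by blast
    then show ?thesis
    proof cases
      case 1
      with q show ?thesis by (intro sum_demicube_antisymmetric[of _ k q]) auto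
    next
      case 2
      with q show ?thesis by (intro sum_demicube_antisymmetric[of _ j q]) auto
    next
      case 3
      with q show ?thesis by (intro sum_demicube_antisymmetric[of _ i q]) auto
    qed
  qed
  have "(\<Sum>y\<in>?D. (x \<bullet> y) ^ 3)
      = (\<Sum>y\<in>?D. \<Sum>i\<in>UNIV. \<Sum>j\<in>UNIV. \<Sum>k\<in>UNIV. x $ i * x $ j * x $ k * (y $ i * y $ j * y $ k))"
    by (simp add: power3_eq_cube inner_vec_def sum_product mult_ac sum_distrib_left sum_distrib_right)
  also have "\<dots> = (\<Sum>i\<in>UNIV. \<Sum>j\<in>UNIV. \<Sum>k\<in>UNIV. x $ i * x $ j * x $ k * (\<Sum>y\<in>?D. y $ i * y $ j * y $ k))"
    by (simp add: sum.swap[of _ UNIV ?D] sum_distrib_left)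
  also have "\<dots> = 0" by (simp add: zero)
  finally show ?thesis .
qed

text \<open>This is the 3-design property: the odd moments vanish and the second moment is constant
  on the sphere.\<close>

lemma sum_demicube_cubic:
  fixes x :: "real ^ 'n::finite"
  assumes "CARD('n) \<ge> 4" "norm x = 1"
  shows "(\<Sum>y\<in>demicube. c0 + c1 * (x \<bullet> y) + c2 * (x \<bullet> y)\<^sup>2 + c3 * (x \<bullet> y) ^ 3)
    = real (card (demicube :: (real ^ 'n) set)) * (c0 + c2 / real CARD('n))"
  using assms
  by (simp add: sum.distrib sum_demicube_inner sum_demicube_inner_square sum_demicube_inner_cube
      distrib_left flip: sum_distrib_left)

section \<open>Points of the sphere with two inner products\<close>

text \<open>A double flip changes the inner product by twice the contribution of two coordinates.
  Hence sums and differences of any two coordinates of \<open>x\<close> lie in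
  \<open>{0, 1, -1}\<close>. Two nonzero coordinates would force all of them to be 1/2 in absolute
  value, and the norm would then require dimension 4.\<close>

lemma demicube_two_inner_products:
  fixes x :: "real ^ 'n::finite"
  assumes n: "CARD('n) \<ge> 5" and x: "norm x = 1"
    and inner: "\<And>y. y \<in> demicube \<Longrightarrow> \<bar>x \<bullet> y\<bar> = 1 / sqrt (real CARD('n))"
  shows "x \<in> cross_polytope"
proof -
  define a where "a = 1 / sqrt (real CARD('n))"
  have a: "a > 0" by (simp add: a_def)
  have diff: "x $ p * y $ p + x $ q * y $ q \<in> {0, a, - a}" if y: "y \<in> demicube" and pq: "p \<noteq> q" for y p q
  proof -
    have "x \<bullet> y - x \<bullet> flip p (flip q y)
      = (\<Sum>k\<in>UNIV. (if k = p then 2 * (x $ k * y $ k) else 0) + (if k = q then 2 * (x $ k * y $ k) else 0))"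
      unfolding inner_vec_def inner_real_def sum_subtractf[symmetric]
      using pq by (intro sum.cong) auto
    also have "\<dots> = 2 * (x $ p * y $ p + x $ q * y $ q)"
      by (simp add: sum.distrib)
    finally have "x \<bullet> y - x \<bullet> flip p (flip q y) = 2 * (x $ p * y $ p + x $ q * y $ q)" .
    moreover have "\<bar>x \<bullet> y\<bar> = a" "\<bar>x \<bullet> flip p (flip q y)\<bar> = a"
      using inner y flip_flip_in_demicube[OF y] by (auto simp: a_def)
    ultimately show ?thesis by (simp add: abs_if split: if_splits)
  qed
  \<comment> \<open>The all-plus point, with zero minus signs, has equal signs at \<open>p\<close>
    and \<open>q\<close> and so yields the sums of coordinates.\<close>
  define y0 :: "real ^ 'n" where "y0 = (\<chi> k. a)"
  have y0: "y0 \<in> demicube"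
    by (simp add: demicube_def y0_def a_def)
  have scale: "s \<in> {0, 1, -1}" if "a * s \<in> {0, a, - a}" for s
  proof -
    have "a * s = a * 0 \<or> a * s = a * 1 \<or> a * s = a * (-1)" using that by simp
    then show ?thesis using a unfolding mult_cancel_left by simp
  qed
  have plus: "x $ p + x $ q \<in> {0, 1, -1}" if "p \<noteq> q" for p q
  proof -
    have "a * (x $ p + x $ q) \<in> {0, a, - a}"
      using diff[OF y0 that] by (simp add: y0_def algebra_simps)
    then show ?thesis by (rule scale)
  qed
  have minus: "x $ p - x $ q \<in> {0, 1, -1}" if "p \<noteq> q" for p q
  proof -
    have "card {p, q} \<le> 2" by (simp add: card_insert_if)
    \<comment> \<open>Flipping \<open>q\<close> and the further index \<open>r\<close> in
      \<open>y0\<close> gives a demicube point with opposite signs at \<open>p\<close> and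
      \<open>q\<close>, hence the differences.\<close>
    then obtain r where "r \<notin> {p, q}" using obtain_fresh_index[of "{p, q}"] n by auto
    then have "a * (x $ p - x $ q) \<in> {0, a, - a}"
      using diff[OF flip_flip_in_demicube[OF y0, of q r] that] that
      by (auto simp: y0_def algebra_simps)
    then show ?thesis by (rule scale)
  qed
  have norm: "(\<Sum>k\<in>UNIV. (x $ k)\<^sup>2) = 1"
    using x by (simp add: norm_eq_sqrt_inner inner_vec_def power2_eq_square)
  have "\<exists>p. x $ p \<noteq> 0" using norm by (metis power_zero_numeral sum.neutral zero_neq_one)
  then obtain p where p: "x $ p \<noteq> 0" ..
  have others: "x $ q = 0" if "q \<noteq> p" for q
  proof (rule ccontr)
    assume q: "x $ q \<noteq> 0"
    \<comment> \<open>The sum and the difference together leave only 0, 1/2 and 1 for the absolute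
      value; 0 is excluded by \<open>p\<close>, and 1 would force the coordinate at \<open>q\<close>
      to vanish.\<close>
    have half: "\<bar>x $ p\<bar> = 1 / 2"
      using plus[of p q] minus[of p q] p q that by auto
    have "(x $ k)\<^sup>2 = 1 / 4" for k
    proof -
      have "\<bar>x $ k\<bar> = 1 / 2"
        using plus[of p k] minus[of p k] half by (cases "k = p") (auto simp: abs_if split: if_splits)
      then have "\<bar>x $ k\<bar>\<^sup>2 = (1 / 2)\<^sup>2" by (rule arg_cong)
      then show ?thesis by (simp add: power_divide)
    qed
    then have "(\<Sum>k\<in>UNIV. (x $ k)\<^sup>2) = (\<Sum>k\<in>(UNIV :: 'n set). 1 / 4)"
      by (rule sum.cong[OF refl])
    then have "real CARD('n) / 4 = 1" using norm by simp
    with n show False by simp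
  qed
  have "(\<Sum>k\<in>UNIV. (x $ k)\<^sup>2) = (\<Sum>k\<in>UNIV. if k = p then (x $ p)\<^sup>2 else 0)"
    using others by (intro sum.cong) auto
  with norm have "x $ p = 1 \<or> x $ p = - 1" by (simp add: power2_eq_1_iff)
  then have "x = axis p 1 \<or> x = - axis p 1"
    using others by (auto simp: vec_eq_iff axis_def)
  then show ?thesis by (auto simp: cross_polytope_def)
qed

section \<open>Minima of the potential\<close>

text \<open>In \<open>ereal\<close> a strict inequality between terms can be absorbed by infinite
  summands on both sides. Here \<open>f\<close> is real-valued, so an infinite \<open>g z\<close>
  already makes the right side strictly larger, and otherwise the comparison is one of real
  sums.\<close>

lemma sum_ereal_strict_mono_ex1:
  fixes f :: "'a \<Rightarrow> real" and g :: "'a \<Rightarrow> ereal"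
  assumes A: "finite A" and le: "\<And>z. z \<in> A \<Longrightarrow> ereal (f z) \<le> g z"
    and less: "\<exists>z\<in>A. ereal (f z) < g z"
  shows "ereal (sum f A) < sum g A"
proof (cases "\<exists>z\<in>A. g z = \<infinity>")
  case True
  with A have "sum g A = \<infinity>" by (simp add: sum_Pinfty)
  then show ?thesis by simp
next
  case False
  have g: "g z = ereal (real_of_ereal (g z))" if "z \<in> A" for z
    using False le[OF that] that by (cases "g z") auto
  have "sum f A < (\<Sum>z\<in>A. real_of_ereal (g z))"
    using A
  proof (rule sum_strict_mono_ex1)
    show "\<forall>z\<in>A. f z \<le> real_of_ereal (g z)" using le g by (metis ereal_less_eq(3))
    show "\<exists>z\<in>A. f z < real_of_ereal (g z)" using less g by (metis ereal_less(2) less_ereal.simps(1))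
  qed
  moreover have "sum g A = ereal (\<Sum>z\<in>A. real_of_ereal (g z))"
    using g by (simp flip: sum_ereal)
  ultimately show ?thesis by simp
qed

theorem theorem3p4:
  fixes g :: "real \<Rightarrow> ereal"
  assumes "CARD('n::finite) \<ge> 5"
    and "admissible_potential g"
    and "has_second_deriv g"
    and "convex_on {-1<..<1} (second_deriv g)"
  shows "(\<forall>x\<in>cross_polytope.
            is_arg_min (potential g demicube) (\<lambda>z. z \<in> sphere 0 1) (x :: real ^ 'n)) \<and>
         (strictly_convex_on {-1<..<1} (second_deriv g) \<longrightarrow>
          (\<forall>x :: real ^ 'n.
            is_arg_min (potential g demicube) (\<lambda>z. z \<in> sphere 0 1) x \<longrightarrow> x \<in> cross_polytope))"
proof -
  let ?D = "demicube :: (real ^ 'n) set"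
  define a where "a = 1 / sqrt (real CARD('n))"
  have a: "0 < a" "a < 1" using assms(1) by (simp_all add: a_def)
  obtain c0 c1 c2 c3 where
    eq: "\<And>t. t = a \<or> t = - a \<Longrightarrow> g t = ereal (c0 + c1 * t + c2 * t\<^sup>2 + c3 * t ^ 3)" and
    le: "\<And>t. t \<in> {-1..1} \<Longrightarrow> ereal (c0 + c1 * t + c2 * t\<^sup>2 + c3 * t ^ 3) \<le> g t" and
    less: "\<And>t. strictly_convex_on {-1<..<1} (second_deriv g) \<Longrightarrow> t \<in> {-1..1} \<Longrightarrow> t \<noteq> a \<Longrightarrow> t \<noteq> - a \<Longrightarrow>
       ereal (c0 + c1 * t + c2 * t\<^sup>2 + c3 * t ^ 3) < g t"
    using admissible_potential_cubic_minorant[OF assms(2-4) a] by metis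
  define h where "h = (\<lambda>t. c0 + c1 * t + c2 * t\<^sup>2 + c3 * t ^ 3)"
  \<comment> \<open>The value of the cubic's potential everywhere on the sphere, hence a lower bound
    for the potential of \<open>g\<close>, attained on the cross-polytope.\<close>
  define C where "C = real (card ?D) * (c0 + c2 / real CARD('n))"
  have const: "(\<Sum>y\<in>?D. h (x \<bullet> y)) = C" if "norm x = 1" for x
    using that assms(1) by (simp add: h_def C_def sum_demicube_cubic)
  have range: "x \<bullet> y \<in> {-1..1}" if "norm x = 1" "y \<in> ?D" for x y
  proof -
    have "y $ i * y $ i = 1 / real CARD('n)" for i
      using demicube_nth[OF that(2), of i] by auto
    then have "norm y = 1" by (simp add: norm_eq_sqrt_inner inner_vec_def)
    then show ?thesis using Cauchy_Schwarz_ineq2[of x y] that(1) by auto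
  qed
  have lower: "ereal C \<le> potential g ?D x" if "norm x = 1" for x
  proof -
    have "ereal (\<Sum>y\<in>?D. h (x \<bullet> y)) \<le> (\<Sum>y\<in>?D. g (x \<bullet> y))"
      unfolding sum_ereal[symmetric] using le range that by (intro sum_mono) (simp add: h_def)
    then show ?thesis using const[OF that] by (simp add: potential_def)
  qed
  have cross: "norm x = 1 \<and> potential g ?D x = ereal C" if "x \<in> cross_polytope" for x :: "real ^ 'n"
  proof
    obtain i where i: "x = axis i 1 \<or> x = - axis i 1" using \<open>x \<in> cross_polytope\<close> by (auto simp: cross_polytope_def)
    then show x: "norm x = 1" by auto
    have "g (x \<bullet> y) = ereal (h (x \<bullet> y))" if "y \<in> ?D" for y
    proof -
      have "x \<bullet> y = y $ i \<or> x \<bullet> y = - y $ i" using i by (auto simp: inner_axis')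
      then have "x \<bullet> y = a \<or> x \<bullet> y = - a" using demicube_nth[OF that, of i] by (auto simp: a_def)
      then show ?thesis unfolding h_def by (rule eq)
    qed
    then show "potential g ?D x = ereal C"
      using const[OF x] by (simp add: potential_def)
  qed
  have "x \<in> cross_polytope"
    if s: "strictly_convex_on {-1<..<1} (second_deriv g)"
      and min: "is_arg_min (potential g ?D) (\<lambda>z. z \<in> sphere 0 1) x" for x :: "real ^ 'n"
  proof (rule demicube_two_inner_products[OF assms(1)])
    show x: "norm x = 1" using min by (simp add: is_arg_min_def)
    obtain e :: "real ^ 'n" where "e \<in> cross_polytope" by (auto simp: cross_polytope_def)
    \<comment> \<open>A minimum point does no worse than \<open>e\<close>, whose potential is
      \<open>C\<close>. Any term with \<open>g\<close> strictly above the cubic would push the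
      potential at \<open>x\<close> above \<open>C\<close>.\<close>
    with cross min have "\<not> ereal C < potential g ?D x" by (force simp: is_arg_min_def)
    then have no: "\<not> (\<exists>y\<in>?D. ereal (h (x \<bullet> y)) < g (x \<bullet> y))"
      using sum_ereal_strict_mono_ex1[OF finite_demicube, of "\<lambda>y. h (x \<bullet> y)" "\<lambda>y. g (x \<bullet> y)"]
        le range[OF x] const[OF x] by (auto simp: h_def potential_def)
    show "\<bar>x \<bullet> y\<bar> = 1 / sqrt (real CARD('n))" if "y \<in> demicube" for y
    proof -
      have "x \<bullet> y = a \<or> x \<bullet> y = - a"
        using no less[OF s range[OF x that]] that by (auto simp: h_def)
      then show ?thesis using a by (auto simp: a_def)
    qed
  qed
  moreover have "is_arg_min (potential g ?D) (\<lambda>z. z \<in> sphere 0 1) x" if "x \<in> cross_polytope" for x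
    using cross[OF that] lower by (auto simp: is_arg_min_def not_less)
  ultimately show ?thesis by blast
qed

end
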